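(* Let $D$ be a diagram with $|G(D)|=0$. If the ghost Kohnert poset $\mathcal{P}_G(D)$ is bounded, then the free cell sequence of $D$ is strictly increasing.
   Context: A diagram is a finite set of cells placed at positions $(r,c)\in\mathbb{Z}_{>0}\times\mathbb{Z}_{>0}$ ($r$ the row, counted from the bottom; $c$ the column), each position holding at most one cell; each cell is either an ordinary cell, written $(r,c)$, or a ghost cell, written $\langle r,c\rangle$. A position is empty if it holds no cell of either kind. $G(D)$ denotes the set of ghost cells of $D$. The ghost move at row $r$ of $D$, with result denoted $\mathcal{G}(D,r)$, is defined as follows: if row $r$ is empty, $\mathcal{G}(D,r)=D$. Otherwise let $c$ be the largest column of a cell in row $r$. If this rightmost cell is a ghost cell, or there is no empty position $(\hat r,c)$ with $\hat r<r$, or, letting $\hat r<r$ be maximal with $(\hat r,c)$ empty, there is a ghost cell $\langle r^*,c\rangle$ with $\hat r<r^*<r$, then $\mathcal{G}(D,r)=D$. Otherwise, with $\hat r<r$ maximal such that $(\hat r,c)$ is empty, $\mathcal{G}(D,r)=(D\setminus\{(r,c)\})\cup\{(\hat r,c),\langle r,c\rangle\}$. $\mathrm{GKD}(D)$ is the set of all diagrams obtainable from $D$ by finite (possibly empty) sequences of ghost moves. The ghost Kohnert poset $\mathcal{P}_G(D)$ has underlying set $\mathrm{GKD}(D)$, with $D_2\preceq D_1$ iff $D_2$ can be obtained from $D_1$ by a finite (possibly empty) sequence of ghost moves. A poset is bounded if it has a unique minimal element and a unique maximal element. For a diagram $D$ with no ghost cells, let $FR(D)$ be the set of rows $r$ for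 which there exist $\hat r<r$ and $c$ with $(r,c)\in D$, $(\hat r,c)\notin D$, and $(r,\tilde c)\notin D$ for all $\tilde c>c$ (rows whose rightmost cell has an empty position somewhere below it in its column). Writing $FR(D)=\{r_1>r_2>\dots>r_n\}$, the free cell sequence of $D$ is $(c_1,\dots,c_n)$ where $c_i=\max\{c : (r_i,c)\in D\}$. *)

theory Defs
  imports Main
begin

datatype cell = is_Cell: Cell (row: nat) (col: nat) | is_Ghost: Ghost (row: nat) (col: nat)

text \<open>Coordinates are positive, so position \<open>(r, c)\<close> requires \<open>0 < r\<close> and \<open>0 < c\<close>; this is
  why every quantification over empty positions below carries an explicit \<open>0 < s\<close>.\<close>

definition diagram :: "cell set \<Rightarrow> bool" where
  "diagram D \<longleftrightarrow> finite D \<and> (\<forall>x\<in>D. 0 < row x \<and> 0 < col x) \<and> inj_on (\<lambda>x. (row x, col x)) D"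

definition ghosts :: "cell set \<Rightarrow> cell set" where
  "ghosts D = {x \<in> D. is_Ghost x}"

definition occupied :: "cell set \<Rightarrow> nat \<Rightarrow> nat \<Rightarrow> bool" where
  "occupied D r c \<longleftrightarrow> Cell r c \<in> D \<or> Ghost r c \<in> D"

definition empty_below :: "cell set \<Rightarrow> nat \<Rightarrow> nat \<Rightarrow> nat set" where
  "empty_below D r c = {s. 0 < s \<and> s < r \<and> \<not> occupied D s c}"

definition ghost_move :: "cell set \<Rightarrow> nat \<Rightarrow> cell set" where
  "ghost_move D r =
    (if \<forall>c. \<not> occupied D r c then D
     else let c = Max {c. occupied D r c}; s = Max (empty_below D r c) in
       if Ghost r c \<in> D \<or> empty_below D r c = {} \<or> (\<exists>t. s < t \<and> t < r \<and> Ghost t c \<in> D)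
       then D
       else (D - {Cell r c}) \<union> {Cell s c, Ghost r c})"

definition ghost_step :: "cell set \<Rightarrow> cell set \<Rightarrow> bool" where
  "ghost_step D D' \<longleftrightarrow> (\<exists>r>0. D' = ghost_move D r)"

definition GKD :: "cell set \<Rightarrow> cell set set" where
  "GKD D = {D'. ghost_step\<^sup>*\<^sup>* D D'}"

text \<open>A pair \<open>(D2, D1)\<close> in the relation means that \<open>D2\<close> lies below \<open>D1\<close>.\<close>

definition ghost_Kohnert_order :: "cell set \<Rightarrow> cell set rel" where
  "ghost_Kohnert_order D = {(D2, D1). D2 \<in> GKD D \<and> D1 \<in> GKD D \<and> ghost_step\<^sup>*\<^sup>* D1 D2}"

definition minimal_in :: "'a set \<Rightarrow> 'a rel \<Rightarrow> 'a \<Rightarrow> bool" where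
  "minimal_in A R x \<longleftrightarrow> x \<in> A \<and> (\<forall>y\<in>A. (y, x) \<in> R \<longrightarrow> y = x)"

definition bounded_poset :: "'a set \<Rightarrow> 'a rel \<Rightarrow> bool" where
  "bounded_poset A R \<longleftrightarrow> (\<exists>!x. minimal_in A R x) \<and> (\<exists>!x. minimal_in A (R\<inverse>) x)"

text \<open>Only meant for diagrams without ghost cells.\<close>

definition free_rows :: "cell set \<Rightarrow> nat set" where
  "free_rows D = {r. \<exists>s c. 0 < s \<and> s < r \<and> Cell r c \<in> D \<and> Cell s c \<notin> D \<and>
                       (\<forall>c'>c. Cell r c' \<notin> D)}"

definition free_cell_sequence :: "cell set \<Rightarrow> nat list" where
  "free_cell_sequence D =
     map (\<lambda>r. Max {c. Cell r c \<in> D}) (rev (sorted_list_of_set (free_rows D)))"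


lemma occupied_iff: "occupied D r c \<longleftrightarrow> (\<exists>x\<in>D. row x = r \<and> col x = c)"
  unfolding occupied_def by (metis cell.exhaust cell.sel)

lemma finite_occupied_row:
  assumes "diagram D" shows "finite {c. occupied D r c}"
proof (rule finite_subset)
  show "{c. occupied D r c} \<subseteq> col ` D" by (auto simp: occupied_iff)
  show "finite (col ` D)" using assms by (simp add: diagram_def)
qed

lemma ghost_move_cases:
  assumes "diagram D"
  obtains "ghost_move D r = D"
  | c s where "Cell r c \<in> D" "Ghost r c \<notin> D" "0 < s" "s < r" "\<not> occupied D s c"
      "ghost_move D r = (D - {Cell r c}) \<union> {Cell s c, Ghost r c}"
proof (cases "ghost_move D r = D")
  case True then show ?thesis using that by blast
next
  case False
  define c where "c = Max {c. occupied D r c}"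
  define s where "s = Max (empty_below D r c)"
  have ne: "{c. occupied D r c} \<noteq> {}" using False by (auto simp: ghost_move_def)
  have occ: "occupied D r c"
    using Max_in[OF finite_occupied_row[OF assms] ne] by (simp add: c_def)
  have g: "Ghost r c \<notin> D" and e: "empty_below D r c \<noteq> {}"
    and eq: "ghost_move D r = (D - {Cell r c}) \<union> {Cell s c, Ghost r c}"
    using False unfolding ghost_move_def Let_def c_def[symmetric] s_def[symmetric]
    by (auto split: if_splits)
  have "finite (empty_below D r c)" by (simp add: empty_below_def)
  then have "s \<in> empty_below D r c" using Max_in e by (simp add: s_def)
  then show ?thesis using that(2) occ g eq by (auto simp: empty_below_def occupied_def)
qed

lemma diagram_ghost_move:
  assumes "diagram D" shows "diagram (ghost_move D r)"
  using assms
proof (cases rule: ghost_move_cases[where r = r])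
  case 1 then show ?thesis using assms by simp
next
  case (2 c s)
  have inj: "x = y" if "x \<in> D" "y \<in> D" "row x = row y" "col x = col y" for x y
    using assms that by (auto simp: diagram_def inj_on_def)
  have n: "row x \<noteq> s \<or> col x \<noteq> c" if "x \<in> D" for x
    using 2(5) that by (auto simp: occupied_iff)
  have m: "x = Cell r c" if "x \<in> D" "row x = r" "col x = c" for x
    using inj[of x "Cell r c"] that 2(1) by simp
  have "inj_on (\<lambda>x. (row x, col x)) (ghost_move D r)"
    unfolding 2(6) inj_on_def using inj n m 2(4) by auto
  moreover have "0 < r" "0 < c" using 2(1) assms by (auto simp: diagram_def)
  ultimately show ?thesis using assms 2 by (auto simp: diagram_def)
qed

lemma card_ghosts_ghost_move:
  assumes "diagram D" "ghost_move D r \<noteq> D"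
  shows "card (ghosts D) < card (ghosts (ghost_move D r))"
  using assms(1)
proof (cases rule: ghost_move_cases[where r = r])
  case 1 then show ?thesis using assms by simp
next
  case (2 c s)
  have "ghosts (ghost_move D r) = insert (Ghost r c) (ghosts D)"
    unfolding 2(6) by (auto simp: ghosts_def)
  moreover have "finite (ghosts D)" using assms by (simp add: diagram_def ghosts_def)
  ultimately show ?thesis using 2(2) by (simp add: ghosts_def)
qed

lemma ghost_steps:
  assumes "ghost_step\<^sup>*\<^sup>* D D'" "diagram D"
  shows "diagram D' \<and> (D' = D \<or> card (ghosts D) < card (ghosts D'))"
  using assms
proof (induction rule: rtranclp_induct)
  case base then show ?case by simp
next
  case (step y z)
  then obtain r where "z = ghost_move y r" by (auto simp: ghost_step_def)
  then show ?case
    using step diagram_ghost_move[of y r] card_ghosts_ghost_move[of y r] by fastforce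
qed

lemma partial_order_ghost_Kohnert_order:
  assumes "diagram D"
  shows "partial_order_on (GKD D) (ghost_Kohnert_order D)"
proof -
  have "antisym (ghost_Kohnert_order D)"
  proof (rule antisymI)
    fix x y assume "(x, y) \<in> ghost_Kohnert_order D" "(y, x) \<in> ghost_Kohnert_order D"
    then have *: "ghost_step\<^sup>*\<^sup>* D x" "ghost_step\<^sup>*\<^sup>* D y" "ghost_step\<^sup>*\<^sup>* x y" "ghost_step\<^sup>*\<^sup>* y x"
      by (auto simp: ghost_Kohnert_order_def GKD_def)
    then have "diagram x" "diagram y" using ghost_steps assms by blast+
    then show "x = y" using ghost_steps[OF *(3)] ghost_steps[OF *(4)] by auto
  qed
  moreover have "trans (ghost_Kohnert_order D)"
    by (rule transI) (auto simp: ghost_Kohnert_order_def intro: rtranclp_trans)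
  moreover have "refl_on (GKD D) (ghost_Kohnert_order D)"
    by (auto simp: refl_on_def ghost_Kohnert_order_def)
  ultimately show ?thesis
    by (auto simp: partial_order_on_def preorder_on_def ghost_Kohnert_order_def)
qed

end

(* If the free cell sequence is not strictly increasing, pick two free rows r2 < r1 with rightmost
   columns c2 \<le> c1 and r1 - r2 minimal. A row strictly between them is not free, so its rightmost
   column is full below; this forces it to be empty from column c2 on. Hence the rightmost cell of
   r1 can slide down one row at a time to row r2 + 1.
   If c2 < c1, it slides one row further to (r2, c1), after which (r2, c2) is never again rightmost
   and never becomes a ghost, whereas moving row r2 first makes it a ghost.
   If c2 = c1 = c, it moves on past (r2, c) and leaves a ghost at (r2 + 1, c), whereas
   moving row r2 first puts a ghost at (r2, c), which stops row r2 + 1 from ever moving in column c.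
   Ghosts persist, so in both cases D has two different minimal elements below it. *)
theory Submission
  imports Defs
begin

section \<open>Invariants of ghost moves and existence of minimal elements\<close>

lemma ghost_step_ghost_move: "0 < r \<Longrightarrow> ghost_step D (ghost_move D r)"
  unfolding ghost_step_def by blast

lemma ghost_steps_invariant:
  assumes "ghost_step\<^sup>*\<^sup>* D D'" "diagram D" "P D"
    and "\<And>E r. diagram E \<Longrightarrow> P E \<Longrightarrow> P (ghost_move E r)"
  shows "P D'"
proof -
  have "diagram D' \<and> P D'"
    using assms(1)
  proof (induction rule: rtranclp_induct)
    case base
    then show ?case using assms by simp
  next
    case (step y z)
    then show ?case using assms(4) diagram_ghost_move by (auto simp: ghost_step_def)
  qed
  then show ?thesis ..
qed

text \<open>A move only lowers a cell within its column and puts a ghost where it was, so a bounding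
  box is never left. This is what limits the number of ghosts.\<close>

lemma ghost_steps_bounded:
  assumes "ghost_step\<^sup>*\<^sup>* D D'" "diagram D" "\<And>x. x \<in> D \<Longrightarrow> row x \<le> K \<and> col x \<le> K"
  shows "\<forall>x\<in>D'. row x \<le> K \<and> col x \<le> K"
proof (rule ghost_steps_invariant[OF assms(1,2)])
  show "\<forall>x\<in>D. row x \<le> K \<and> col x \<le> K" using assms(3) by blast
next
  fix E r assume "diagram E" and IH: "\<forall>x\<in>E. row x \<le> K \<and> col x \<le> K"
  from this(1) show "\<forall>x\<in>ghost_move E r. row x \<le> K \<and> col x \<le> K"
    by (cases rule: ghost_move_cases[where r = r]) (use IH in force)+
qed

lemma card_ghosts_le:
  assumes "\<forall>x\<in>D. row x \<le> K \<and> col x \<le> K"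
  shows "card (ghosts D) \<le> Suc K * Suc K"
proof -
  have "ghosts D \<subseteq> (\<lambda>(r, c). Ghost r c) ` ({..K} \<times> {..K})"
    using assms by (auto simp: ghosts_def is_Ghost_def image_iff)
  then have "card (ghosts D) \<le> card ({..K} \<times> {..K})"
    by (meson card_image_le card_mono finite_SigmaI finite_atMost finite_imageI le_trans)
  then show ?thesis by simp
qed

text \<open>Every nontrivial move adds a ghost, and the bounding box limits their number. Hence a
  diagram reachable from \<open>E\<close> with the most ghosts is minimal.\<close>

lemma minimal_below:
  assumes "diagram D" "E \<in> GKD D"
  obtains M where "minimal_in (GKD D) (ghost_Kohnert_order D) M" "ghost_step\<^sup>*\<^sup>* E M"
proof -
  have E: "ghost_step\<^sup>*\<^sup>* D E" "diagram E"
    using assms ghost_steps by (auto simp: GKD_def)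
  obtain K where K: "\<And>x. x \<in> E \<Longrightarrow> row x \<le> K \<and> col x \<le> K"
  proof
    have fin: "finite (row ` E \<union> col ` E)" using E(2) by (simp add: diagram_def)
    show "row x \<le> Max (row ` E \<union> col ` E) \<and> col x \<le> Max (row ` E \<union> col ` E)" if "x \<in> E" for x
      using that by (intro conjI Max_ge[OF fin]) auto
  qed
  have "card (ghosts X) < Suc (Suc K * Suc K)" if "ghost_step\<^sup>*\<^sup>* E X" for X
    using card_ghosts_le[OF ghost_steps_bounded[OF that E(2) K]] by simp
  then obtain M where M: "ghost_step\<^sup>*\<^sup>* E M"
    and max: "\<And>X. ghost_step\<^sup>*\<^sup>* E X \<Longrightarrow> card (ghosts X) \<le> card (ghosts M)"
    using ex_has_greatest_nat[of "\<lambda>X. ghost_step\<^sup>*\<^sup>* E X" E "\<lambda>X. card (ghosts X)"] by blast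
  have "diagram M" using ghost_steps[OF M E(2)] by blast
  then have "X = M" if "ghost_step\<^sup>*\<^sup>* M X" for X
    using ghost_steps[OF that] max[OF rtranclp_trans[OF M that]] by simp
  then have "minimal_in (GKD D) (ghost_Kohnert_order D) M"
    using rtranclp_trans[OF E(1) M] by (auto simp: minimal_in_def GKD_def ghost_Kohnert_order_def)
  then show ?thesis using that M by blast
qed

text \<open>Below each of \<open>E\<close> and \<open>F\<close> there is a minimal element, and
  uniqueness makes the two coincide.\<close>

lemma bounded_confluent:
  assumes "diagram D" "bounded_poset (GKD D) (ghost_Kohnert_order D)"
    and "ghost_step\<^sup>*\<^sup>* D E" "ghost_step\<^sup>*\<^sup>* D F"
  obtains M where "ghost_step\<^sup>*\<^sup>* E M" "ghost_step\<^sup>*\<^sup>* F M"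
proof -
  have "E \<in> GKD D" "F \<in> GKD D" using assms(3,4) by (simp_all add: GKD_def)
  then show ?thesis
    using minimal_below[OF assms(1)] assms(2) that unfolding bounded_poset_def by metis
qed

section \<open>Ghosts that persist and ghosts that can never appear\<close>

lemma ghost_in_ghost_moveI:
  assumes "diagram D" "Ghost r c \<in> D"
  shows "Ghost r c \<in> ghost_move D k"
  using assms(1)
  by (cases rule: ghost_move_cases[where r = k]) (use assms(2) in auto)

lemma ghost_persists:
  assumes "ghost_step\<^sup>*\<^sup>* D D'" "diagram D" "Ghost r c \<in> D"
  shows "Ghost r c \<in> D'"
  by (rule ghost_steps_invariant[where P = "\<lambda>X. Ghost r c \<in> X", OF assms ghost_in_ghost_moveI])

text \<open>A new ghost replaces the rightmost cell of the moved row. A ghost directly below that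
  cell would lie strictly above the landing row, which forbids the move.\<close>

lemma ghost_in_ghost_moveD:
  assumes "diagram D" "Ghost r c \<in> ghost_move D k" "Ghost r c \<notin> D"
  shows "k = r" "\<And>c'. occupied D r c' \<Longrightarrow> c' \<le> c" "\<And>t. Suc t = r \<Longrightarrow> Ghost t c \<notin> D"
proof -
  define m where "m = Max {c. occupied D k c}"
  define s where "s = Max (empty_below D k m)"
  have eq: "ghost_move D k = D - {Cell k m} \<union> {Cell s m, Ghost k m}"
    and e: "empty_below D k m \<noteq> {}" and g: "\<And>t. s < t \<Longrightarrow> t < k \<Longrightarrow> Ghost t m \<notin> D"
    using assms(2,3) unfolding ghost_move_def Let_def m_def[symmetric] s_def[symmetric]
    by (auto split: if_splits)
  then have r: "r = k" and m: "m = c" using assms(2,3) by auto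
  show "k = r" using r by simp
  show "c' \<le> c" if "occupied D r c'" for c'
    using that Max_ge[OF finite_occupied_row[OF assms(1)]] r m m_def by auto
  show "Ghost t c \<notin> D" if "Suc t = r" for t
  proof
    assume t: "Ghost t c \<in> D"
    have "s \<in> empty_below D k m" unfolding s_def by (rule Max_in[OF _ e]) (simp add: empty_below_def)
    then have "s < k" "\<not> occupied D s c" using m by (auto simp: empty_below_def)
    \<comment> \<open>The landing row is at most \<open>t\<close>, and it is not \<open>t\<close>
      because the ghost occupies that position.\<close>
    then have "s < t" using t that r by (metis less_SucE occupied_def)
    then show False using g t that r m by blast
  qed
qed

lemma occupied_ghost_move:
  assumes "diagram D" "occupied D r c"
  shows "occupied (ghost_move D k) r c"
  using assms(1)
  by (cases rule: ghost_move_cases[where r = k]) (use assms(2) in \<open>auto simp: occupied_def\<close>)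

text \<open>Positions never become empty, so column \<open>c\<close> is never the rightmost one of
  row \<open>r\<close>.\<close>

lemma no_ghost_left_of_occupied:
  assumes "ghost_step\<^sup>*\<^sup>* D D'" "diagram D" "occupied D r c'" "c < c'" "Ghost r c \<notin> D"
  shows "Ghost r c \<notin> D'"
proof -
  have "occupied D' r c' \<and> Ghost r c \<notin> D'"
  proof (rule ghost_steps_invariant[OF assms(1,2)])
    fix E k assume "diagram E" "occupied E r c' \<and> Ghost r c \<notin> E"
    then show "occupied (ghost_move E k) r c' \<and> Ghost r c \<notin> ghost_move E k"
      using ghost_in_ghost_moveD(2) occupied_ghost_move assms(4) by (metis leD)
  qed (use assms in blast)
  then show ?thesis by blast
qed

text \<open>The lower ghost persists, and it blocks any move of a cell directly above it.\<close>

lemma no_ghost_above_ghost: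
  assumes "ghost_step\<^sup>*\<^sup>* D D'" "diagram D" "Ghost r c \<in> D" "Ghost (Suc r) c \<notin> D"
  shows "Ghost (Suc r) c \<notin> D'"
proof -
  have "Ghost r c \<in> D' \<and> Ghost (Suc r) c \<notin> D'"
  proof (rule ghost_steps_invariant[OF assms(1,2)])
    fix E k assume "diagram E" "Ghost r c \<in> E \<and> Ghost (Suc r) c \<notin> E"
    then show "Ghost r c \<in> ghost_move E k \<and> Ghost (Suc r) c \<notin> ghost_move E k"
      using ghost_in_ghost_moveD(3) ghost_in_ghost_moveI by blast
  qed (use assms in blast)
  then show ?thesis by blast
qed

section \<open>Explicit moves and sliding a cell down its column\<close>

lemma ghost_move_eq:
  assumes "diagram D" "Cell r c \<in> D" "\<And>c'. c < c' \<Longrightarrow> \<not> occupied D r c'"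
    and "0 < s" "s < r" "\<not> occupied D s c" "\<And>t. t < r \<Longrightarrow> Ghost t c \<notin> D"
  shows "ghost_move D r = (D - {Cell r c}) \<union> {Cell (Max (empty_below D r c)) c, Ghost r c}"
proof -
  have occ: "occupied D r c" using assms(2) by (simp add: occupied_def)
  have max: "Max {c. occupied D r c} = c"
    by (rule Max_eqI[OF finite_occupied_row[OF assms(1)]])
      (use occ assms(3) in \<open>auto simp: not_less[symmetric]\<close>)
  have "Ghost r c \<notin> D"
  proof
    assume "Ghost r c \<in> D"
    with assms(1,2) have "Ghost r c = Cell r c"
      unfolding diagram_def by (metis (mono_tags, lifting) cell.sel inj_onD)
    then show False by simp
  qed
  moreover have "empty_below D r c \<noteq> {}" using assms(4-6) by (auto simp: empty_below_def)
  ultimately show ?thesis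
    using occ assms(7) unfolding ghost_move_def Let_def max by auto
qed

text \<open>The position directly below is empty, so each move descends exactly one row, and the
  cell is again rightmost where it lands. The last clause carries facts about untouched positions
  over to the result.\<close>

lemma slide_down:
  assumes "diagram D" "Cell r c \<in> D" "\<And>c'. c < c' \<Longrightarrow> \<not> occupied D r c'"
    and "0 < m" "m \<le> r" "\<And>t c'. m \<le> t \<Longrightarrow> t < r \<Longrightarrow> c \<le> c' \<Longrightarrow> \<not> occupied D t c'"
    and "\<And>t. t < r \<Longrightarrow> Ghost t c \<notin> D"
  obtains D' where "ghost_step\<^sup>*\<^sup>* D D'" "Cell m c \<in> D'"
    "\<And>x. row x < m \<or> col x \<noteq> c \<Longrightarrow> x \<in> D' \<longleftrightarrow> x \<in> D"
proof -
  have "\<exists>D'. ghost_step\<^sup>*\<^sup>* D D' \<and> Cell m c \<in> D'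
    \<and> (\<forall>x. row x < m \<or> col x \<noteq> c \<longrightarrow> (x \<in> D' \<longleftrightarrow> x \<in> D))"
    using assms
  proof (induction r arbitrary: D)
    case 0
    then show ?case by blast
  next
    case (Suc k)
    show ?case
    proof (cases "m = Suc k")
      case True
      then show ?thesis using Suc.prems by blast
    next
      case False
      then have mk: "m \<le> k" using Suc.prems by simp
      define E where "E = ghost_move D (Suc k)"
      have nocc: "\<not> occupied D k c" using Suc.prems(6)[of k c] mk by simp
      have "Max (empty_below D (Suc k) c) = k"
        by (rule Max_eqI) (use nocc mk \<open>0 < m\<close> in \<open>auto simp: empty_below_def\<close>)
      moreover have "ghost_move D (Suc k) = D - {Cell (Suc k) c}
          \<union> {Cell (Max (empty_below D (Suc k) c)) c, Ghost (Suc k) c}"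
        using Suc.prems(4) mk nocc
        by (intro ghost_move_eq[OF Suc.prems(1-3), where s = k] Suc.prems(7)) auto
      ultimately have E: "E = D - {Cell (Suc k) c} \<union> {Cell k c, Ghost (Suc k) c}"
        by (simp add: E_def)
      have dE: "diagram E" unfolding E_def by (rule diagram_ghost_move[OF Suc.prems(1)])
      have step: "ghost_step D E" unfolding E_def by (rule ghost_step_ghost_move) simp
      have agree: "x \<in> E \<longleftrightarrow> x \<in> D" if "row x < k \<or> col x \<noteq> c" for x
        using that unfolding E by auto
      have occ: "occupied E t c' \<longleftrightarrow> occupied D t c'" if "t < k \<or> c' \<noteq> c" for t c'
        using that agree[of "Cell t c'"] agree[of "Ghost t c'"] by (simp add: occupied_def)
      have "\<exists>D'. ghost_step\<^sup>*\<^sup>* E D' \<and> Cell m c \<in> D'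
          \<and> (\<forall>x. row x < m \<or> col x \<noteq> c \<longrightarrow> (x \<in> D' \<longleftrightarrow> x \<in> E))"
      proof (rule Suc.IH[OF dE _ _ \<open>0 < m\<close> mk])
        show "Cell k c \<in> E" by (simp add: E)
        show "\<not> occupied E k c'" if "c < c'" for c'
          using that occ Suc.prems(6)[of k c'] mk by simp
        show "\<not> occupied E t c'" if "m \<le> t" "t < k" "c \<le> c'" for t c'
          using that occ Suc.prems(6)[of t c'] by simp
        \<comment> \<open>The ghost just left behind is in row \<open>Suc k\<close>, above the cell,
          so it does not block further moves.\<close>
        show "Ghost t c \<notin> E" if "t < k" for t
          using that agree[of "Ghost t c"] Suc.prems(7)[of t] by simp
      qed
      then obtain D' where D': "ghost_step\<^sup>*\<^sup>* E D'" "Cell m c \<in> D'"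
        "\<And>x. row x < m \<or> col x \<noteq> c \<Longrightarrow> x \<in> D' \<longleftrightarrow> x \<in> E"
        by blast
      have "ghost_step\<^sup>*\<^sup>* D D'" using step D'(1) by (rule converse_rtranclp_into_rtranclp)
      moreover have "x \<in> D' \<longleftrightarrow> x \<in> D" if "row x < m \<or> col x \<noteq> c" for x
        using D'(3)[OF that] agree[of x] that mk by auto
      ultimately show ?thesis using D'(2) by blast
    qed
  qed
  then show ?thesis using that by blast
qed

section \<open>Rightmost cells and comparison of free rows\<close>

lemma rightmost_cell:
  assumes "finite D" "Cell r c0 \<in> D"
  defines "c \<equiv> Max {c. Cell r c \<in> D}"
  shows "Cell r c \<in> D" "\<And>c'. Cell r c' \<in> D \<Longrightarrow> c' \<le> c"
proof -
  have fin: "finite {c. Cell r c \<in> D}"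
  proof (rule finite_subset)
    show "{c. Cell r c \<in> D} \<subseteq> col ` D" by force
    show "finite (col ` D)" using assms(1) by simp
  qed
  then show "Cell r c \<in> D" "\<And>c'. Cell r c' \<in> D \<Longrightarrow> c' \<le> c"
    using assms Max_in[OF fin] Max_ge[OF fin] by auto
qed

text \<open>Identifies the column that witnesses freeness with the \<open>Max\<close> used in
  \<open>free_cell_sequence\<close>.\<close>

lemma free_rowsE:
  assumes "finite D" "r \<in> free_rows D"
  obtains s where "Cell r (Max {c. Cell r c \<in> D}) \<in> D" "0 < s" "s < r"
    "Cell s (Max {c. Cell r c \<in> D}) \<notin> D"
proof -
  obtain s c where *: "0 < s" "s < r" "Cell r c \<in> D" "Cell s c \<notin> D" "\<And>c'. c < c' \<Longrightarrow> Cell r c' \<notin> D"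
    using assms(2) unfolding free_rows_def by blast
  have "Max {c. Cell r c \<in> D} = c"
    using rightmost_cell[OF assms(1) *(3)] *(3,5) by (metis le_neq_implies_less)
  with * show ?thesis using that by blast
qed

text \<open>The witness is the rightmost column of row \<open>t\<close>: a gap below it would make
  the row free.\<close>

lemma nonfree_row:
  assumes "finite D" "t \<notin> free_rows D" "Cell t c \<in> D"
  obtains c' where "c \<le> c'" "\<And>s. 0 < s \<Longrightarrow> s < t \<Longrightarrow> Cell s c' \<in> D"
proof
  show "c \<le> Max {c. Cell t c \<in> D}" using rightmost_cell(2)[OF assms(1,3)] assms(3) by blast
  have "\<forall>c'>Max {c. Cell t c \<in> D}. Cell t c' \<notin> D"
    using rightmost_cell(2)[OF assms(1,3)] leD by blast
  then show "Cell s (Max {c. Cell t c \<in> D}) \<in> D" if "0 < s" "s < t" for s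
    using rightmost_cell(1)[OF assms(1,3)] assms(2) that unfolding free_rows_def by blast
qed

text \<open>Both cases end alike: one reachable diagram contains a ghost that can never appear below
  another, although confluence gives a common \<open>M\<close>.\<close>

lemma consecutive_free_rows:
  assumes D: "diagram D" "ghosts D = {}" and bnd: "bounded_poset (GKD D) (ghost_Kohnert_order D)"
    and free: "r1 \<in> free_rows D" "r2 \<in> free_rows D" and less: "r2 < r1"
    and between: "\<And>t. r2 < t \<Longrightarrow> t < r1 \<Longrightarrow> t \<notin> free_rows D"
  shows "Max {c. Cell r1 c \<in> D} < Max {c. Cell r2 c \<in> D}" (is "?c1 < ?c2")
proof (rule ccontr)
  assume "\<not> ?c1 < ?c2"
  define c1 c2 where "c1 = ?c1" and "c2 = ?c2"
  have le: "c2 \<le> c1" using \<open>\<not> ?c1 < ?c2\<close> by (simp add: c1_def c2_def)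
  have fin: "finite D" using D(1) by (simp add: diagram_def)
  have noghost: "Ghost r c \<notin> D" for r c using D(2) by (auto simp: ghosts_def)
  have occ: "occupied D r c \<longleftrightarrow> Cell r c \<in> D" for r c using noghost by (simp add: occupied_def)
  have "Cell r1 c1 \<in> D" using free_rowsE[OF fin free(1)] c1_def by blast
  moreover have "Cell r1 c' \<notin> D" if "c1 < c'" for c'
    using rightmost_cell(2)[OF fin, of r1] that leD unfolding c1_def by blast
  ultimately have R1: "Cell r1 c1 \<in> D" "\<And>c'. c1 < c' \<Longrightarrow> \<not> occupied D r1 c'" by (simp_all add: occ)
  obtain s where s: "Cell r2 c2 \<in> D" "0 < s" "s < r2" "Cell s c2 \<notin> D"
    using free_rowsE[OF fin free(2)] c2_def by blast
  have R2: "\<And>c'. c2 < c' \<Longrightarrow> \<not> occupied D r2 c'"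
    using rightmost_cell(2)[OF fin, of r2] leD unfolding c2_def occ by blast
  \<comment> \<open>Otherwise some column \<open>c'\<close> with \<open>c \<le> c'\<close> is full
    below row \<open>t\<close> and so meets row \<open>r2\<close>. Since \<open>c2\<close> is
    rightmost there, \<open>c'\<close> equals \<open>c2\<close>, contradicting the gap at row
    \<open>s\<close>.\<close>
  have mid: "\<not> occupied D t c" if t: "r2 < t" "t < r1" "c2 \<le> c" for t c
  proof
    assume "occupied D t c"
    then obtain c' where c': "c \<le> c'" "\<And>s. 0 < s \<Longrightarrow> s < t \<Longrightarrow> Cell s c' \<in> D"
      using nonfree_row[OF fin between[OF t(1,2)]] occ by blast
    then have "Cell r2 c' \<in> D" using s t by simp
    then have "c' = c2" using R2 c'(1) t(3) occ by (metis le_antisym not_less order_trans)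
    then show False using c'(2)[of s] s t by simp
  qed
  define F where "F = ghost_move D r2"
  have F: "F = D - {Cell r2 c2} \<union> {Cell (Max (empty_below D r2 c2)) c2, Ghost r2 c2}"
    unfolding F_def by (rule ghost_move_eq[OF D(1) s(1) R2 s(2,3)]) (simp_all add: s(4) occ noghost)
  have stepF: "ghost_step\<^sup>*\<^sup>* D F" unfolding F_def using s by (intro r_into_rtranclp ghost_step_ghost_move) simp
  have dF: "diagram F" unfolding F_def by (rule diagram_ghost_move[OF D(1)])
  show False
  proof (cases "c2 = c1")
    case False
    obtain E where E: "ghost_step\<^sup>*\<^sup>* D E" "Cell r2 c1 \<in> E"
      "\<And>x. row x < r2 \<or> col x \<noteq> c1 \<Longrightarrow> x \<in> E \<longleftrightarrow> x \<in> D"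
    proof (rule slide_down[OF D(1) R1, where m = r2])
      \<comment> \<open>Row \<open>r2\<close> itself is free from column \<open>c1\<close> on
        because \<open>c2 < c1\<close>, so the slide may end there.\<close>
      show "\<not> occupied D t c'" if "r2 \<le> t" "t < r1" "c1 \<le> c'" for t c'
        using that mid[of t c'] R2[of c'] le False by (cases "t = r2") auto
    qed (use noghost s less in auto)
    have dE: "diagram E" using ghost_steps[OF E(1) D(1)] by blast
    obtain M where M: "ghost_step\<^sup>*\<^sup>* E M" "ghost_step\<^sup>*\<^sup>* F M"
      using bounded_confluent[OF D(1) bnd E(1) stepF] .
    have "Ghost r2 c2 \<in> M" by (rule ghost_persists[OF M(2) dF]) (simp add: F)
    moreover have "Ghost r2 c2 \<notin> M"
    proof (rule no_ghost_left_of_occupied[OF M(1) dE, of _ c1])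
      show "occupied E r2 c1" using E(2) by (simp add: occupied_def)
      show "Ghost r2 c2 \<notin> E" using E(3)[of "Ghost r2 c2"] noghost False by simp
    qed (use le False in simp)
    ultimately show False by contradiction
  next
    case True
    \<comment> \<open>Now \<open>Cell r2 c2\<close> lies in the same column, so the slide stops just
      above it. The next move jumps over it, since column \<open>c1\<close> still has the gap at row
      \<open>s\<close>.\<close>
    obtain E where E: "ghost_step\<^sup>*\<^sup>* D E" "Cell (Suc r2) c1 \<in> E"
      "\<And>x. row x < Suc r2 \<or> col x \<noteq> c1 \<Longrightarrow> x \<in> E \<longleftrightarrow> x \<in> D"
      by (rule slide_down[OF D(1) R1, where m = "Suc r2"]) (use noghost mid True less in auto)
    have dE: "diagram E" using ghost_steps[OF E(1) D(1)] by blast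
    have occE: "occupied E r c \<longleftrightarrow> occupied D r c" if "r < Suc r2 \<or> c \<noteq> c1" for r c
      using that E(3)[of "Cell r c"] E(3)[of "Ghost r c"] by (simp add: occupied_def)
    define E' where "E' = ghost_move E (Suc r2)"
    have "E' = E - {Cell (Suc r2) c1}
        \<union> {Cell (Max (empty_below E (Suc r2) c1)) c1, Ghost (Suc r2) c1}"
      unfolding E'_def
    proof (rule ghost_move_eq[OF dE E(2), where s = s])
      show "\<not> occupied E (Suc r2) c'" if "c1 < c'" for c'
        using that R1(2)[of c'] mid[of "Suc r2" c'] occE[of "Suc r2" c'] True less
        \<comment> \<open>Either the slide is trivial and the row is \<open>r1\<close>, or the row
          lies strictly between and \<open>mid\<close> applies.\<close>
        by (cases "r1 = Suc r2") auto
      show "\<not> occupied E s c1" using occE[of s c1] s occ True by simp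
      show "Ghost t c1 \<notin> E" if "t < Suc r2" for t using that E(3)[of "Ghost t c1"] noghost by simp
    qed (use s in auto)
    then have gE': "Ghost (Suc r2) c1 \<in> E'" by simp
    have "ghost_step E E'" unfolding E'_def by (rule ghost_step_ghost_move) simp
    then have stepE': "ghost_step\<^sup>*\<^sup>* D E'" using E(1) by simp
    have dE': "diagram E'" unfolding E'_def by (rule diagram_ghost_move[OF dE])
    obtain M where M: "ghost_step\<^sup>*\<^sup>* E' M" "ghost_step\<^sup>*\<^sup>* F M"
      using bounded_confluent[OF D(1) bnd stepE' stepF] .
    have "Ghost (Suc r2) c1 \<in> M" by (rule ghost_persists[OF M(1) dE' gE'])
    moreover have "Ghost (Suc r2) c1 \<notin> M"
      by (rule no_ghost_above_ghost[OF M(2) dF]) (auto simp: F True noghost)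
    ultimately show False by contradiction
  qed
qed

text \<open>A free row in between splits the claim into two with smaller row distance; otherwise the
  rows are consecutive.\<close>

lemma free_rows_antitone:
  assumes "diagram D" "ghosts D = {}" "bounded_poset (GKD D) (ghost_Kohnert_order D)"
    and "r1 \<in> free_rows D" "r2 \<in> free_rows D" "r2 < r1"
  shows "Max {c. Cell r1 c \<in> D} < Max {c. Cell r2 c \<in> D}"
  using assms(4-6)
proof (induction "r1 - r2" arbitrary: r1 r2 rule: less_induct)
  case less
  show ?case
  proof (cases "\<exists>t\<in>free_rows D. r2 < t \<and> t < r1")
    case True
    then obtain t where t: "t \<in> free_rows D" "r2 < t" "t < r1" by blast
    have "Max {c. Cell r1 c \<in> D} < Max {c. Cell t c \<in> D}" using less t by simp
    also have "\<dots> < Max {c. Cell r2 c \<in> D}" using less t by simp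
    finally show ?thesis .
  next
    case False
    then show ?thesis using consecutive_free_rows[OF assms(1-3)] less.prems by blast
  qed
qed

theorem theorem3p13:
  fixes D :: "cell set"
  assumes "diagram D"
    and "card (ghosts D) = 0"
    and "bounded_poset (GKD D) (ghost_Kohnert_order D)"
  shows "sorted_wrt (<) (free_cell_sequence D)"
proof -
  have fin: "finite D" using assms(1) by (simp add: diagram_def)
  \<comment> \<open>Finiteness matters here, as \<open>card\<close> is 0 on infinite sets
    too.\<close>
  then have no_ghosts: "ghosts D = {}" using assms(2) by (simp add: ghosts_def)
  have "finite (free_rows D)"
  proof (rule finite_subset)
    show "free_rows D \<subseteq> row ` D" unfolding free_rows_def by force
    show "finite (row ` D)" using fin by simp
  qed
  \<comment> \<open>The rows are listed upwards here and reversed in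
    \<open>free_cell_sequence\<close>, so the relation is flipped.\<close>
  then have "sorted_wrt (\<lambda>r r'. Max {c. Cell r' c \<in> D} < Max {c. Cell r c \<in> D})
      (sorted_list_of_set (free_rows D))"
    using free_rows_antitone[OF assms(1) no_ghosts assms(3)]
    by (intro sorted_wrt_mono_rel[OF _ strict_sorted_list_of_set]) auto
  then show ?thesis by (simp add: free_cell_sequence_def sorted_wrt_map sorted_wrt_rev)
qed

end
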